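(* Let $A\in\mathbb{R}^{m\times n}$ with $m\ge n$ have full rank and nonzero rows, let $p_1,\dots,p_m>0$ with $\sum_i p_i=1$, and let $x\in\mathbb{R}^n$. Let $\eta\in\mathbb{R}^m$ be a random noise vector whose entries $\eta_i$ are i.i.d. with zero mean and variance $\sigma^2$, and let $y=Ax+\eta$. Run the randomized Kaczmarz algorithm on $(A,y)$ with row-selection probabilities $p_i$ (row selections independent of $\eta$) from a fixed starting point $x^{(0)}\in\mathbb{R}^n$ not depending on $\eta$, and let $z^{(k)}=x^{(k)}-x$. Then the mean squared error at the $k$th iteration, averaged over both the randomness of the algorithm and the noise, is $$ \mathbb{E}_{\eta}\,\mathbb{E}\,\|z^{(k)}\|^2=\operatorname{vec}(I_n)^T\Big[Q^k\big(z^{(0)}\otimes z^{(0)}-\mathbb{E}_{\eta}v_1\big)-\mathbb{E}_{\eta}\big(f_k(D)\,v_2\big)\Big]+\operatorname{tr}\,\operatorname{mat}(\mathbb{E}_{\eta}v_1), $$ where $f_k(D)=\sum_{0\le\ell<k}Q^{\ell}DP^{k-1-\ell}$, $v_2=(I-P)^{-1}f$, $v_1=(I-Q)^{-1}\,[\,e+Dv_2\,]$, and $P,Q,D,e,f$ are as defined in the context.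
   Context: Randomized Kaczmarz algorithm: let $a_i\in\mathbb{R}^n$ be the (column vector of the) $i$th row of $A$. Indices $i_1,i_2,\dots$ are drawn independently, with $\Pr(i_k=i)=p_i$, and $$x^{(k)}=x^{(k-1)}+\frac{y_{i_k}-a_{i_k}^Tx^{(k-1)}}{\|a_{i_k}\|^2}\,a_{i_k}.$$ $\mathbb{E}$ denotes the conditional expectation over the random row selections with $\eta$ held fixed, and $\mathbb{E}_{\eta}$ denotes the average over the noise $\eta$. Notation: $\tilde a_i=a_i/\|a_i\|$; $\tilde\eta_i=\eta_i/\|a_i\|$; $P_i^{\perp}=I_n-\tilde a_i\tilde a_i^T$; $\otimes$ is the Kronecker product; $\operatorname{vec}$ stacks the columns of a matrix vertically into a vector, and $\operatorname{mat}$ is its inverse, producing an $n\times n$ matrix from an $n^2$-dimensional vector; $I$ denotes the identity matrix of the appropriate size. Define - $P=\sum_i p_i P_i^{\perp}\in\mathbb{R}^{n\times n}$, - $Q=\sum_i p_i\,(P_i^{\perp}\otimes P_i^{\perp})\in\mathbb{R}^{n^2\times n^2}$, - $D=\sum_i p_i\tilde\eta_i\,(\tilde a_i\otimes P_i^{\perp}+P_i^{\perp}\otimes\tilde a_i)\in\mathbb{R}^{n^2\times n}$ (with $\tilde a_i$ regarded as an $n\times 1$ matrix), - $f=\sum_i p_i\tilde\eta_i\tilde a_i\in\mathbb{R}^n$, - $e=\sum_i p_i\tilde\eta_i^{2}\,(\tilde a_i\otimes\tilde a_i)\in\mathbb{R}^{n^2}$. The quantities $D,f,e,v_1,v_2$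 depend on $\eta$ and are therefore random; $P$ and $Q$ are deterministic. *)

theory Defs
  imports "HOL-Probability.Probability"
begin

text \<open>
  The space of dimension \<open>n\<^sup>2\<close> is \<open>real ^ ('n \<times> 'n)\<close>. An index pair \<open>(i, j)\<close> is
  ordered with \<open>i\<close> as the block index and \<open>j\<close> as the position inside the block, so that
  \<open>(j, i)\<close> addresses entry \<open>i\<close> of column \<open>j\<close> in a vectorized matrix.
\<close>

definition kron :: "real^'b^'a \<Rightarrow> real^'d^'c \<Rightarrow> real^('b \<times> 'd)^('a \<times> 'c)" where
  "kron A B = (\<chi> r c. A $ fst r $ fst c * B $ snd r $ snd c)"

definition kron_vec :: "real^'a \<Rightarrow> real^'b \<Rightarrow> real^('a \<times> 'b)" where
  "kron_vec u v = (\<chi> r. u $ fst r * v $ snd r)"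

text \<open>
  Kronecker products of a vector, taken as a one-column matrix, with a matrix. The column
  index of such a product lies in \<open>1 \<times> 'd\<close> or \<open>'b \<times> 1\<close>; the trivial factor is dropped.
\<close>

definition kron_vec_mat :: "real^'a \<Rightarrow> real^'d^'c \<Rightarrow> real^'d^('a \<times> 'c)" where
  "kron_vec_mat u B = (\<chi> r c. kron (columnvector u :: real^1^'a) B $ r $ (1, c))"

definition kron_mat_vec :: "real^'b^'a \<Rightarrow> real^'c \<Rightarrow> real^'b^('a \<times> 'c)" where
  "kron_mat_vec A v = (\<chi> r c. kron A (columnvector v :: real^1^'c) $ r $ (c, 1))"

lemma kron_columnvector:
  "kron (columnvector u :: real^1^'a) (columnvector v :: real^1^'b) = columnvector (kron_vec u v)"
  by (simp add: kron_def kron_vec_def columnvector_def vec_eq_iff)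

definition vec_of_mat :: "real^'c^'r \<Rightarrow> real^('c \<times> 'r)" where
  "vec_of_mat X = (\<chi> q. X $ snd q $ fst q)"

definition mat_of_vec :: "real^('c \<times> 'r) \<Rightarrow> real^'c^'r" where
  "mat_of_vec w = (\<chi> i j. w $ (j, i))"

lemma mat_of_vec_vec_of_mat: "mat_of_vec (vec_of_mat X) = X"
  by (simp add: mat_of_vec_def vec_of_mat_def vec_eq_iff)

lemma vec_of_mat_mat_of_vec: "vec_of_mat (mat_of_vec w) = w"
  by (simp add: mat_of_vec_def vec_of_mat_def vec_eq_iff)

text \<open>The overloaded power on \<open>real^'n^'n\<close> would be the entrywise one.\<close>

primrec matpow :: "real^'n^'n \<Rightarrow> nat \<Rightarrow> real^'n^'n" where
  "matpow A 0 = mat 1"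
| "matpow A (Suc k) = A ** matpow A k"

text \<open>\<open>i k\<close> is the row used in the step from iterate \<open>k\<close> to iterate \<open>k + 1\<close>.\<close>

primrec kaczmarz :: "real^'n^'m \<Rightarrow> real^'m \<Rightarrow> real^'n \<Rightarrow> (nat \<Rightarrow> 'm) \<Rightarrow> nat \<Rightarrow> real^'n" where
  "kaczmarz A y x0 i 0 = x0"
| "kaczmarz A y x0 i (Suc k) =
     kaczmarz A y x0 i k +
       ((y $ i k - row (i k) A \<bullet> kaczmarz A y x0 i k) / (norm (row (i k) A))\<^sup>2) *\<^sub>R row (i k) A"

text \<open>In the following, \<open>h\<close> is a realization of the noise vector.\<close>

definition nrow :: "real^'n^'m \<Rightarrow> 'm \<Rightarrow> real^'n" where
  "nrow A i = row i A /\<^sub>R norm (row i A)"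

definition nnoise :: "real^'n^'m \<Rightarrow> real^'m \<Rightarrow> 'm \<Rightarrow> real" where
  "nnoise A h i = h $ i / norm (row i A)"

definition proj_perp :: "real^'n^'m \<Rightarrow> 'm \<Rightarrow> real^'n^'n" where
  "proj_perp A i =
     mat 1 - (columnvector (nrow A i) :: real^1^'n) ** (rowvector (nrow A i) :: real^'n^1)"

definition P_mat :: "real^'n^'m \<Rightarrow> ('m \<Rightarrow> real) \<Rightarrow> real^'n^'n" where
  "P_mat A p = (\<Sum>i\<in>UNIV. p i *\<^sub>R proj_perp A i)"

definition Q_mat :: "real^'n^'m \<Rightarrow> ('m \<Rightarrow> real) \<Rightarrow> real^('n \<times> 'n)^('n \<times> 'n)" where
  "Q_mat A p = (\<Sum>i\<in>UNIV. p i *\<^sub>R kron (proj_perp A i) (proj_perp A i))"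

definition D_mat :: "real^'n^'m \<Rightarrow> ('m \<Rightarrow> real) \<Rightarrow> real^'m \<Rightarrow> real^'n^('n \<times> 'n)" where
  "D_mat A p h =
     (\<Sum>i\<in>UNIV. (p i * nnoise A h i) *\<^sub>R
        (kron_vec_mat (nrow A i) (proj_perp A i) + kron_mat_vec (proj_perp A i) (nrow A i)))"

definition f_vec :: "real^'n^'m \<Rightarrow> ('m \<Rightarrow> real) \<Rightarrow> real^'m \<Rightarrow> real^'n" where
  "f_vec A p h = (\<Sum>i\<in>UNIV. (p i * nnoise A h i) *\<^sub>R nrow A i)"

definition e_vec :: "real^'n^'m \<Rightarrow> ('m \<Rightarrow> real) \<Rightarrow> real^'m \<Rightarrow> real^('n \<times> 'n)" where
  "e_vec A p h = (\<Sum>i\<in>UNIV. (p i * (nnoise A h i)\<^sup>2) *\<^sub>R kron_vec (nrow A i) (nrow A i))"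

definition v2_vec :: "real^'n^'m \<Rightarrow> ('m \<Rightarrow> real) \<Rightarrow> real^'m \<Rightarrow> real^'n" where
  "v2_vec A p h = matrix_inv (mat 1 - P_mat A p) *v f_vec A p h"

definition v1_vec :: "real^'n^'m \<Rightarrow> ('m \<Rightarrow> real) \<Rightarrow> real^'m \<Rightarrow> real^('n \<times> 'n)" where
  "v1_vec A p h =
     matrix_inv (mat 1 - Q_mat A p) *v (e_vec A p h + D_mat A p h *v v2_vec A p h)"

definition fk_mat ::
  "real^'n^'m \<Rightarrow> ('m \<Rightarrow> real) \<Rightarrow> nat \<Rightarrow> real^'n^('n \<times> 'n) \<Rightarrow> real^'n^('n \<times> 'n)" where
  "fk_mat A p k D =
     (\<Sum>l<k. matpow (Q_mat A p) l ** D ** matpow (P_mat A p) (k - 1 - l))"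

text \<open>
  Row selections and noise live on one probability space \<open>M\<close>. Averaging over the row
  selections with the noise held fixed is conditional expectation given the sigma-algebra
  generated by the noise.
\<close>

definition cond_exp_given ::
  "'a measure \<Rightarrow> ('a \<Rightarrow> 'b::topological_space) \<Rightarrow> ('a \<Rightarrow> real) \<Rightarrow> 'a \<Rightarrow> real" where
  "cond_exp_given M \<eta> g = real_cond_exp M (vimage_algebra (space M) \<eta> borel) g"

end

theory Submission
  imports Defs
begin

text \<open>
  The error obeys \<open>z' = P\<^sub>i z + n\<^sub>i a\<^sub>i\<close>, with \<open>P\<^sub>i\<close> the projection orthogonal to the
  normalized row \<open>a\<^sub>i\<close> and \<open>n\<^sub>i\<close> the normalized noise. For a fixed noise vector, averaging
  over the row selections gives two linear recursions, \<open>m' = P m + f\<close> for the mean of \<open>z\<close> and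
  \<open>S' = Q S + D m + e\<close> for the mean of \<open>z \<otimes> z\<close>, with fixed points \<open>v\<^sub>2\<close> and \<open>v\<^sub>1\<close>.
  Hence \<open>S\<^sub>k = Q\<^sup>k (z\<^sub>0 \<otimes> z\<^sub>0 - v\<^sub>1) + v\<^sub>1 + f\<^sub>k(D) (z\<^sub>0 - v\<^sub>2)\<close>, and the squared error is
  the trace of \<open>S\<^sub>k\<close>. Since \<open>D\<close> is linear in the centred noise, the term in \<open>f\<^sub>k(D) z\<^sub>0\<close>
  averages to zero. The fixed points exist because a fixed vector of \<open>P\<close> or \<open>Q\<close> is fixed by
  every projection in the average, hence orthogonal to all rows, hence zero by full rank.
\<close>

section \<open>Matrix-vector identities\<close>

lemma matrix_vector_mult_sum_left:
  fixes B :: "'b \<Rightarrow> real^'n^'m"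
  shows "(\<Sum>s\<in>S. B s) *v w = (\<Sum>s\<in>S. B s *v w)"
  by (induction S rule: infinite_finite_induct) (auto simp: matrix_vector_mult_add_rdistrib)

lemma matrix_vector_mult_sum_right:
  fixes B :: "real^'n^'m"
  shows "B *v (\<Sum>s\<in>S. g s) = (\<Sum>s\<in>S. B *v g s)"
  by (induction S rule: infinite_finite_induct) (auto simp: matrix_vector_right_distrib)

text \<open>A square matrix with trivial kernel is invertible. Since \<open>matrix_inv\<close> is a
  choice term, its defining equation becomes available only once an inverse is known to
  exist.\<close>

lemma inverse_matrix_vector:
  fixes B :: "real^'n^'n"
  assumes "\<And>w. B *v w = 0 \<Longrightarrow> w = 0"
  shows "B *v (matrix_inv B *v v) = v"
proof -
  have "invertible B"
    using assms matrix_left_invertible_ker[of B] by (auto simp: invertible_left_inverse)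
  then have "B ** matrix_inv B = mat 1"
    unfolding invertible_def matrix_inv_def by (rule someI2_ex) auto
  then show ?thesis
    by (simp add: matrix_vector_mul_assoc)
qed

text \<open>Each term of \<open>w \<bullet> w - w \<bullet> (\<Sum>s. q s *\<^sub>R B s) *v w\<close> is \<open>q s\<close> times the squared norm of
  \<open>w - B s *v w\<close>, so all of them vanish.\<close>

lemma fixed_by_weighted_projections:
  fixes B :: "'s::finite \<Rightarrow> real^'n^'n"
  assumes pos: "\<And>s. q s > 0" and total: "(\<Sum>s\<in>UNIV. q s) = 1"
    and idem: "\<And>s v. B s *v (B s *v v) = B s *v v"
    and sym: "\<And>s u v. (B s *v u) \<bullet> v = u \<bullet> (B s *v v)"
    and fixed: "(\<Sum>s\<in>UNIV. q s *\<^sub>R B s) *v w = w"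
  shows "B s *v w = w"
proof -
  have gap: "w \<bullet> w - w \<bullet> (B t *v w) = (norm (w - B t *v w))\<^sup>2" for t
    using idem[of t w] sym[of t w "B t *v w"]
    by (simp add: power2_norm_eq_inner inner_diff_left inner_diff_right inner_commute)
  have "w \<bullet> w = (\<Sum>t\<in>UNIV. q t * (w \<bullet> (B t *v w)))"
    using arg_cong[OF fixed, of "(\<bullet>) w"]
    by (simp add: matrix_vector_mult_sum_left scaleR_matrix_vector_assoc[symmetric] inner_sum_right)
  moreover have "w \<bullet> w = (\<Sum>t\<in>UNIV. q t * (w \<bullet> w))"
    using total by (simp flip: sum_distrib_right)
  ultimately have "(\<Sum>t\<in>UNIV. q t * (norm (w - B t *v w))\<^sup>2) = 0"
    by (simp flip: gap add: right_diff_distrib sum_subtractf)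
  then have "q s * (norm (w - B s *v w))\<^sup>2 = 0"
    using pos by (subst (asm) sum_nonneg_eq_0_iff) (auto simp: less_imp_le)
  then show ?thesis
    using pos[of s] by simp
qed

section \<open>Kronecker products and the trace pairing\<close>

lemma kron_mult_kron_vec: "kron B C *v kron_vec u v = kron_vec (B *v u) (C *v v)"
  by (simp add: vec_eq_iff kron_def kron_vec_def matrix_vector_mult_def sum_product
      sum.cartesian_product UNIV_Times_UNIV[symmetric] case_prod_beta mult_ac del: UNIV_Times_UNIV)

text \<open>As in the vector case, a sum over pairs factors into a product of two sums. Hence
  Kronecker squares of projections are again idempotent.\<close>

lemma kron_mult_kron: "kron B C ** kron B' C' = kron (B ** B') (C ** C')"
  by (simp add: vec_eq_iff kron_def matrix_matrix_mult_def sum_product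
      sum.cartesian_product UNIV_Times_UNIV[symmetric] case_prod_beta mult_ac del: UNIV_Times_UNIV)

lemma transpose_kron: "transpose (kron B C) = kron (transpose B) (transpose C)"
  by (simp add: vec_eq_iff kron_def transpose_def)

lemma kron_vec_mat_mult: "kron_vec_mat u B *v v = kron_vec u (B *v v)"
  by (simp add: vec_eq_iff kron_vec_mat_def kron_def kron_vec_def columnvector_def
      matrix_vector_mult_def sum_distrib_left mult_ac)

lemma kron_mat_vec_mult: "kron_mat_vec B u *v v = kron_vec (B *v v) u"
  by (simp add: vec_eq_iff kron_mat_vec_def kron_def kron_vec_def columnvector_def
      matrix_vector_mult_def sum_distrib_left mult_ac)

lemma kron_vec_add_left: "kron_vec (u + u') v = kron_vec u v + kron_vec u' v"
  by (simp add: vec_eq_iff kron_vec_def algebra_simps)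

lemma kron_vec_add_right: "kron_vec u (v + v') = kron_vec u v + kron_vec u v'"
  by (simp add: vec_eq_iff kron_vec_def algebra_simps)

lemma kron_vec_scaleR_left: "kron_vec (c *\<^sub>R u) v = c *\<^sub>R kron_vec u v"
  by (simp add: vec_eq_iff kron_vec_def)

lemma kron_vec_scaleR_right: "kron_vec u (c *\<^sub>R v) = c *\<^sub>R kron_vec u v"
  by (simp add: vec_eq_iff kron_vec_def)

text \<open>The vectorized identity picks out exactly the diagonal entries. This turns the second
  moment of the error into the mean squared norm.\<close>

lemma vec_mat_1_inner: "vec_of_mat (mat 1 :: real^'n^'n) \<bullet> w = trace (mat_of_vec w)"
proof -
  have "vec_of_mat (mat 1 :: real^'n^'n) \<bullet> w = (\<Sum>a\<in>UNIV. \<Sum>b\<in>UNIV. if a = b then w $ (a, b) else 0)"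
    unfolding sum.cartesian_product
    by (auto simp: inner_vec_def vec_of_mat_def mat_def case_prod_beta intro!: sum.cong)
  then show ?thesis
    by (simp add: trace_def mat_of_vec_def)
qed

lemma trace_mat_of_kron_vec: "trace (mat_of_vec (kron_vec u v)) = u \<bullet> v"
  by (simp add: trace_def mat_of_vec_def kron_vec_def inner_vec_def)

text \<open>A unit vector in the first factor selects one block of \<open>w\<close>, so vectors in
  the tensor space can be tested block by block.\<close>

lemma inner_kron_vec_axis:
  fixes w :: "real^('a::finite \<times> 'b::finite)"
  shows "w \<bullet> kron_vec (axis r 1) u = (\<chi> c. w $ (r, c)) \<bullet> u"
proof -
  have "w \<bullet> kron_vec (axis r 1) u = (\<Sum>a\<in>UNIV. \<Sum>c\<in>UNIV. if a = r then w $ (a, c) * u $ c else 0)"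
    unfolding sum.cartesian_product
    by (auto simp: inner_vec_def kron_vec_def axis_def case_prod_beta intro!: sum.cong)
  also have "\<dots> = (\<Sum>c\<in>UNIV. w $ (r, c) * u $ c)"
    by (subst sum.swap) simp
  finally show ?thesis
    by (simp add: inner_vec_def)
qed

section \<open>The row projections\<close>

lemma proj_perp_mult:
  fixes A :: "real^'b^'a"
  shows "proj_perp A r *v z = z - (nrow A r \<bullet> z) *\<^sub>R nrow A r"
proof -
  have "((columnvector u :: real^1^'b) ** (rowvector u :: real^'b^1)) *v z = (u \<bullet> z) *\<^sub>R u"
    for u z :: "real^'b"
    by (simp add: vec_eq_iff columnvector_def rowvector_def matrix_matrix_mult_def
        matrix_vector_mult_def inner_vec_def sum_distrib_left mult_ac)
  then show ?thesis
    by (simp add: proj_perp_def matrix_vector_mult_diff_rdistrib)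
qed

lemma norm_nrow: "row r A \<noteq> 0 \<Longrightarrow> norm (nrow A r) = 1"
  by (simp add: nrow_def)

lemma inner_nrow_nrow: "row r A \<noteq> 0 \<Longrightarrow> nrow A r \<bullet> nrow A r = 1"
  using norm_nrow[of r A] by (simp add: norm_eq_1)

lemma transpose_proj_perp: "transpose (proj_perp A r) = proj_perp A r"
  by (simp add: proj_perp_def vec_eq_iff transpose_def columnvector_def rowvector_def
      matrix_matrix_mult_def mat_def mult_ac)

lemma proj_perp_idem: "row r A \<noteq> 0 \<Longrightarrow> proj_perp A r ** proj_perp A r = proj_perp A r"
  by (simp add: matrix_eq flip: matrix_vector_mul_assoc)
    (simp add: proj_perp_mult inner_diff_right inner_nrow_nrow)

lemma inner_symmetric_matrix:
  fixes B :: "real^'n^'n"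
  assumes "transpose B = B"
  shows "(B *v u) \<bullet> v = u \<bullet> (B *v v)"
  using assms by (metis dot_lmul_matrix transpose_matrix_vector)

section \<open>Full rank and the fixed points of the two recursions\<close>

lemma inner_nrow_all_0:
  fixes A :: "real^'n^'m"
  assumes "inj ((*v) A)" and "\<And>r. row r A \<noteq> 0" and "\<And>r. nrow A r \<bullet> w = 0"
  shows "w = 0"
proof -
  have "row r A \<bullet> w = 0" for r
    using assms(2,3)[of r] by (simp add: nrow_def)
  then have "A *v w = A *v 0"
    by (simp add: vec_eq_iff matrix_vector_mult_def row_def inner_vec_def)
  then show ?thesis
    using assms(1) by (rule injD[rotated])
qed

text \<open>A vector fixed by the average is fixed by each row projection, so its component along
  every row vanishes. Thus \<open>mat 1 - P_mat A p\<close> has trivial kernel.\<close>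

lemma P_mat_fixed:
  fixes A :: "real^'n^'m"
  assumes inj: "inj ((*v) A)" and rows: "\<And>r. row r A \<noteq> 0"
    and "\<And>r. p r > 0" and "(\<Sum>r\<in>UNIV. p r) = 1" and "P_mat A p *v w = w"
  shows "w = 0"
proof -
  have fixed: "proj_perp A r *v w = w" for r
  proof (rule fixed_by_weighted_projections[where q = p])
    show "proj_perp A s *v (proj_perp A s *v v) = proj_perp A s *v v" for s v
      by (simp only: matrix_vector_mul_assoc proj_perp_idem[OF rows])
    show "(\<Sum>s\<in>UNIV. p s *\<^sub>R proj_perp A s) *v w = w"
      using assms(5) by (simp only: P_mat_def)
  qed (use assms(3,4) inner_symmetric_matrix[OF transpose_proj_perp] in blast)+
  have "nrow A r \<bullet> w = 0" for r
    using fixed[of r] rows[of r] norm_nrow[of r A] by (auto simp: proj_perp_mult)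
  then show ?thesis
    by (rule inner_nrow_all_0[OF inj rows])
qed

text \<open>Each \<open>kron (proj_perp A r) (proj_perp A r)\<close> is also symmetric and
  idempotent, so the averaging argument applies again. Every block of \<open>w\<close> then turns
  out to be orthogonal to all rows.\<close>

lemma Q_mat_fixed:
  fixes A :: "real^'n^'m"
  assumes inj: "inj ((*v) A)" and rows: "\<And>r. row r A \<noteq> 0"
    and "\<And>r. p r > 0" and "(\<Sum>r\<in>UNIV. p r) = 1" and "Q_mat A p *v w = w"
  shows "w = 0"
proof -
  let ?K = "\<lambda>r. kron (proj_perp A r) (proj_perp A r)"
  have sym: "transpose (?K r) = ?K r" for r
    by (simp add: transpose_kron transpose_proj_perp)
  have fixed: "?K r *v w = w" for r
  proof (rule fixed_by_weighted_projections[where q = p])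
    show "?K s *v (?K s *v v) = ?K s *v v" for s v
      by (simp only: matrix_vector_mul_assoc kron_mult_kron proj_perp_idem[OF rows])
    show "(\<Sum>s\<in>UNIV. p s *\<^sub>R ?K s) *v w = w"
      using assms(5) by (simp only: Q_mat_def)
  qed (use assms(3,4) inner_symmetric_matrix[OF sym] in blast)+
  have "(\<chi> c. w $ (s, c)) = 0" for s
  proof (rule inner_nrow_all_0[OF inj rows])
    fix r
    \<comment> \<open>Symmetry moves the Kronecker projection onto the test vector, which it kills
      because \<open>proj_perp A r\<close> annihilates \<open>nrow A r\<close>.\<close>
    have "(\<chi> c. w $ (s, c)) \<bullet> nrow A r = (?K r *v w) \<bullet> kron_vec (axis s 1) (nrow A r)"
      by (simp add: inner_kron_vec_axis fixed)
    also have "\<dots> = w \<bullet> (?K r *v kron_vec (axis s 1) (nrow A r))"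
      by (rule inner_symmetric_matrix[OF sym])
    also have "\<dots> = 0"
      using rows[of r]
      by (simp add: kron_mult_kron_vec proj_perp_mult[of A r "nrow A r"] inner_nrow_nrow)
        (simp add: kron_vec_def inner_vec_def)
    finally show "nrow A r \<bullet> (\<chi> c. w $ (s, c)) = 0"
      by (simp add: inner_commute)
  qed
  then show ?thesis
    by (simp add: vec_eq_iff)
qed

lemma v2_vec_fixpoint:
  fixes A :: "real^'n^'m"
  assumes "inj ((*v) A)" and "\<And>r. row r A \<noteq> 0"
    and "\<And>r. p r > 0" and "(\<Sum>r\<in>UNIV. p r) = 1"
  shows "P_mat A p *v v2_vec A p h + f_vec A p h = v2_vec A p h"
proof -
  have "(mat 1 - P_mat A p) *v v2_vec A p h = f_vec A p h"
    unfolding v2_vec_def using P_mat_fixed[OF assms]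
    by (intro inverse_matrix_vector) (simp add: matrix_vector_mult_diff_rdistrib)
  then show ?thesis
    by (simp add: matrix_vector_mult_diff_rdistrib diff_eq_eq add.commute)
qed

lemma v1_vec_fixpoint:
  fixes A :: "real^'n^'m"
  assumes "inj ((*v) A)" and "\<And>r. row r A \<noteq> 0"
    and "\<And>r. p r > 0" and "(\<Sum>r\<in>UNIV. p r) = 1"
  shows "Q_mat A p *v v1_vec A p h + (e_vec A p h + D_mat A p h *v v2_vec A p h) = v1_vec A p h"
proof -
  have "(mat 1 - Q_mat A p) *v v1_vec A p h = e_vec A p h + D_mat A p h *v v2_vec A p h"
    unfolding v1_vec_def using Q_mat_fixed[OF assms]
    by (intro inverse_matrix_vector) (simp add: matrix_vector_mult_diff_rdistrib)
  then show ?thesis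
    by (simp add: matrix_vector_mult_diff_rdistrib diff_eq_eq add.commute)
qed

section \<open>Averaging over the row selections\<close>

text \<open>A list of rows records the selections with the latest one first.\<close>

definition path_avg :: "('m \<Rightarrow> real) \<Rightarrow> nat \<Rightarrow> ('m::finite list \<Rightarrow> 'v::real_vector) \<Rightarrow> 'v" where
  "path_avg p k F = (\<Sum>rs | length rs = k. prod_list (map p rs) *\<^sub>R F rs)"

lemma finite_lists_length [simp]: "finite {rs :: 'm::finite list. length rs = k}"
  using finite_lists_length_eq[of "UNIV :: 'm set" k] by simp

lemma path_avg_0 [simp]: "path_avg p 0 F = F []"
  by (simp add: path_avg_def)

text \<open>The head of a list is the latest selection. Averaging over it first, with the earlier
  history fixed, yields one-step recursions.\<close>

lemma path_avg_Suc:
  fixes F :: "'m::finite list \<Rightarrow> 'v::real_vector"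
  shows "path_avg p (Suc k) F = path_avg p k (\<lambda>rs. \<Sum>r\<in>UNIV. p r *\<^sub>R F (r # rs))"
proof -
  have "bij_betw (\<lambda>(rs, r). r # rs) ({rs :: 'm list. length rs = k} \<times> UNIV) {rs. length rs = Suc k}"
    by (auto simp: bij_betw_def inj_on_def length_Suc_conv image_iff)
  from sum.reindex_bij_betw[OF this, of "\<lambda>rs. prod_list (map p rs) *\<^sub>R F rs"]
  have "path_avg p (Suc k) F =
      (\<Sum>(rs, r)\<in>{rs. length rs = k} \<times> UNIV. prod_list (map p (r # rs)) *\<^sub>R F (r # rs))"
    unfolding path_avg_def by (simp add: case_prod_beta)
  then show ?thesis
    by (simp add: path_avg_def sum.cartesian_product[symmetric] scaleR_sum_right mult.commute)
qed

lemma path_avg_const: "(\<Sum>r\<in>UNIV. p r) = 1 \<Longrightarrow> path_avg p k (\<lambda>_. c) = c"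
  by (induction k) (simp_all add: path_avg_Suc flip: scaleR_left.sum)

lemma path_avg_add: "path_avg p k (\<lambda>rs. F rs + G rs) = path_avg p k F + path_avg p k G"
  by (simp add: path_avg_def scaleR_add_right sum.distrib)

lemma path_avg_linear: "linear T \<Longrightarrow> path_avg p k (\<lambda>rs. T (F rs)) = T (path_avg p k F)"
  by (simp add: path_avg_def linear_sum linear_scale)

text \<open>The error is written as a function of a finite history instead of an infinite selection
  sequence, so only finitely many cases arise for each length.\<close>

primrec path_error :: "real^'n^'m \<Rightarrow> real^'n \<Rightarrow> real^'m \<Rightarrow> 'm list \<Rightarrow> real^'n" where
  "path_error A z0 h [] = z0"
| "path_error A z0 h (r # rs) = proj_perp A r *v path_error A z0 h rs + nnoise A h r *\<^sub>R nrow A r"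

text \<open>The residual of row \<open>r\<close> is the noise entry minus the inner product of the
  row with the current error, so a step projects the error and adds normalized noise. The reversal
  puts the latest selection first.\<close>

lemma kaczmarz_eq_path_error:
  assumes "\<And>r. row r A \<noteq> 0"
  shows "kaczmarz A (A *v x + h) x0 s k - x = path_error A (x0 - x) h (map s (rev [0..<k]))"
proof (induction k)
  case (Suc k)
  have "(A *v x + h) $ r = row r A \<bullet> x + h $ r" for r
    by (simp add: matrix_vector_mult_def row_def inner_vec_def)
  then show ?case
    using assms[of "s k"]
    by (simp flip: Suc.IH add: proj_perp_mult nrow_def nnoise_def inner_diff_right power2_eq_square
        scaleR_left_distrib[symmetric] scaleR_left_diff_distrib[symmetric] field_simps)
qed simp

section \<open>Recursions and closed forms for the first two moments\<close>

lemma path_avg_error_Suc: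
  fixes A :: "real^'n^'m"
  assumes "(\<Sum>r\<in>UNIV. p r) = 1"
  shows "path_avg p (Suc k) (path_error A z0 h) =
    P_mat A p *v path_avg p k (path_error A z0 h) + f_vec A p h"
proof -
  have step: "(\<Sum>r\<in>UNIV. p r *\<^sub>R path_error A z0 h (r # rs)) =
      P_mat A p *v path_error A z0 h rs + f_vec A p h" for rs
    by (simp add: P_mat_def f_vec_def matrix_vector_mult_sum_left scaleR_matrix_vector_assoc
        scaleR_add_right sum.distrib)
  show ?thesis
    unfolding path_avg_Suc step path_avg_add path_avg_const[OF assms]
    by (simp add: path_avg_linear[where T = "(*v) (P_mat A p)"] matrix_vector_mul_linear)
qed

text \<open>Expanding the Kronecker square of the updated error gives four terms: the quadratic one
  averages to \<open>Q_mat\<close>, the two mixed ones to \<open>D_mat\<close>, and the squared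
  noise to \<open>e_vec\<close>.\<close>

lemma path_avg_kron_error_Suc:
  fixes A :: "real^'n^'m" and z0 :: "real^'n" and h :: "real^'m"
  assumes "(\<Sum>r\<in>UNIV. p r) = 1"
  defines "Z \<equiv> path_error A z0 h"
  shows "path_avg p (Suc k) (\<lambda>rs. kron_vec (Z rs) (Z rs)) =
    Q_mat A p *v path_avg p k (\<lambda>rs. kron_vec (Z rs) (Z rs)) +
      D_mat A p h *v path_avg p k Z + e_vec A p h"
proof -
  have step: "(\<Sum>r\<in>UNIV. p r *\<^sub>R kron_vec (Z (r # rs)) (Z (r # rs))) =
      Q_mat A p *v kron_vec (Z rs) (Z rs) + D_mat A p h *v Z rs + e_vec A p h" for rs
    by (simp add: Z_def Q_mat_def D_mat_def e_vec_def matrix_vector_mult_sum_left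
        scaleR_matrix_vector_assoc[symmetric] kron_mult_kron_vec matrix_vector_mult_add_rdistrib
        kron_vec_mat_mult kron_mat_vec_mult kron_vec_add_left kron_vec_add_right
        kron_vec_scaleR_left kron_vec_scaleR_right scaleR_add_right sum.distrib power2_eq_square
        ac_simps)
  show ?thesis
    unfolding path_avg_Suc step path_avg_add path_avg_const[OF assms(1)]
    by (simp add: path_avg_linear[where T = "(*v) (Q_mat A p)"]
        path_avg_linear[where T = "(*v) (D_mat A p h)"] matrix_vector_mul_linear)
qed

text \<open>Subtracting the fixed point \<open>v2_vec\<close> makes the affine recursion
  linear.\<close>

lemma path_avg_error:
  fixes A :: "real^'n^'m"
  assumes "inj ((*v) A)" and "\<And>r. row r A \<noteq> 0"
    and "\<And>r. p r > 0" and "(\<Sum>r\<in>UNIV. p r) = 1"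
  shows "path_avg p k (path_error A z0 h) =
    matpow (P_mat A p) k *v (z0 - v2_vec A p h) + v2_vec A p h"
proof (induction k)
  case (Suc k)
  then show ?case
    using v2_vec_fixpoint[OF assms, of h]
    by (simp add: path_avg_error_Suc[OF assms(4)] matrix_vector_right_distrib
        matrix_vector_mul_assoc add.assoc)
qed simp

text \<open>The term for \<open>l = 0\<close> is \<open>D ** matpow (P_mat A p) k\<close>; every
  later term carries a leading factor \<open>Q_mat A p\<close>.\<close>

lemma fk_mat_Suc: "fk_mat A p (Suc k) D = D ** matpow (P_mat A p) k + Q_mat A p ** fk_mat A p k D"
  unfolding matrix_eq
  by (simp add: fk_mat_def sum.lessThan_Suc_shift matrix_vector_mult_add_rdistrib
      matrix_vector_mult_sum_left matrix_vector_mult_sum_right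
      del: sum.lessThan_Suc flip: matrix_vector_mul_assoc)

text \<open>In the forcing term \<open>D_mat\<close> times the mean error, the stationary part
  \<open>v2_vec\<close> is absorbed by the fixed point \<open>v1_vec\<close>, while the transient
  part accumulates into \<open>fk_mat\<close>.\<close>

lemma path_avg_kron_error:
  fixes A :: "real^'n^'m" and z0 :: "real^'n" and h :: "real^'m"
  assumes "inj ((*v) A)" and "\<And>r. row r A \<noteq> 0"
    and "\<And>r. p r > 0" and "(\<Sum>r\<in>UNIV. p r) = 1"
  defines "Z \<equiv> path_error A z0 h"
  shows "path_avg p k (\<lambda>rs. kron_vec (Z rs) (Z rs)) =
    matpow (Q_mat A p) k *v (kron_vec z0 z0 - v1_vec A p h) + v1_vec A p h +
      fk_mat A p k (D_mat A p h) *v (z0 - v2_vec A p h)"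
proof (induction k)
  case 0
  then show ?case
    by (simp add: Z_def fk_mat_def)
next
  case (Suc k)
  let ?v1 = "v1_vec A p h" and ?v2 = "v2_vec A p h" and ?Q = "Q_mat A p" and ?D = "D_mat A p h"
  have "path_avg p (Suc k) (\<lambda>rs. kron_vec (Z rs) (Z rs)) =
      ?Q *v (matpow ?Q k *v (kron_vec z0 z0 - ?v1) + ?v1 + fk_mat A p k ?D *v (z0 - ?v2)) +
        ?D *v (matpow (P_mat A p) k *v (z0 - ?v2) + ?v2) + e_vec A p h"
    using Suc.IH unfolding Z_def
    by (simp add: path_avg_kron_error_Suc[OF assms(4)] path_avg_error[OF assms(1-4)])
  \<comment> \<open>Regrouping exposes the fixed-point equation of \<open>v1_vec\<close> and the
    recursion of \<open>fk_mat\<close>.\<close>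
  also have "\<dots> = matpow ?Q (Suc k) *v (kron_vec z0 z0 - ?v1) +
      (?Q *v ?v1 + (e_vec A p h + ?D *v ?v2)) + fk_mat A p (Suc k) ?D *v (z0 - ?v2)"
    by (simp only: matpow.simps fk_mat_Suc matrix_vector_mult_add_rdistrib matrix_vector_right_distrib
        matrix_vector_mul_assoc[symmetric] add_ac)
  finally show ?case
    by (simp add: v1_vec_fixpoint[OF assms(1-4)])
qed

text \<open>The squared norm is the trace of the outer product, a linear functional of
  \<open>kron_vec z z\<close>, and therefore commutes with the average.\<close>

lemma path_avg_norm_error:
  fixes A :: "real^'n^'m"
  shows "path_avg p k (\<lambda>rs. (norm (path_error A z0 h rs))\<^sup>2) =
    vec_of_mat (mat 1 :: real^'n^'n) \<bullet>
      path_avg p k (\<lambda>rs. kron_vec (path_error A z0 h rs) (path_error A z0 h rs))"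
proof -
  have "(norm z)\<^sup>2 = vec_of_mat (mat 1 :: real^'n^'n) \<bullet> kron_vec z z" for z :: "real^'n"
    by (simp add: vec_mat_1_inner trace_mat_of_kron_vec power2_norm_eq_inner)
  then show ?thesis
    by (simp add: path_avg_linear[where T = "(\<bullet>) (vec_of_mat (mat 1 :: real^'n^'n))"]
        bounded_linear.linear bounded_linear_inner_right)
qed

section \<open>Independence of selections and noise\<close>

lemma measurable_vec_lambda:
  fixes X :: "'a \<Rightarrow> real^'m"
  assumes "\<And>r. (\<lambda>\<omega>. X \<omega> $ r) \<in> borel_measurable M"
  shows "X \<in> borel_measurable M"
proof -
  have "X = (\<lambda>\<omega>. \<Sum>r\<in>UNIV. X \<omega> $ r *\<^sub>R axis r 1)"
    by (metis (no_types, lifting) basis_expansion ext scalar_mult_eq_scaleR sum.cong)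
  also have "\<dots> \<in> borel_measurable M"
    using assms by (intro borel_measurable_sum borel_measurable_scaleR) simp_all
  finally show ?thesis .
qed

text \<open>The indicator of \<open>B\<close> and \<open>g\<close> of \<open>X\<close> are
  independent real variables, because each generates a sigma-algebra inside one of the two
  independent ones. Here \<open>B\<close> stands for a selection event and \<open>X\<close> for the
  noise.\<close>

lemma (in prob_space) indep_set_expectation:
  fixes g :: "'b::topological_space \<Rightarrow> real"
  assumes indep: "indep_set \<A> (sets (vimage_algebra (space M) X borel))"
    and X: "random_variable borel X"
    and B: "B \<in> \<A>"
    and alg: "sigma_algebra (space M) \<A>"
    and g: "g \<in> borel_measurable borel" and int: "integrable M (\<lambda>\<omega>. g (X \<omega>))"
  shows "integrable M (\<lambda>\<omega>. indicat_real B \<omega> * g (X \<omega>))" (is ?int)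
    and "expectation (\<lambda>\<omega>. indicat_real B \<omega> * g (X \<omega>)) = prob B * expectation (\<lambda>\<omega>. g (X \<omega>))"
      (is ?eq)
proof -
  interpret \<A>: sigma_algebra "space M" \<A>
    by (rule alg)
  have B_event: "B \<in> events"
    using indep_setD_ev1[OF indep] B by auto
  have indep': "indep_var borel (indicat_real B) borel (\<lambda>\<omega>. g (X \<omega>))"
  proof (unfold indep_var_eq, intro conjI)
    show "random_variable borel (indicat_real B)"
      using B_event by simp
    show "random_variable borel (\<lambda>\<omega>. g (X \<omega>))"
      using X g by (rule measurable_compose)
    have sub1: "sigma_sets (space M) {indicat_real B -` A \<inter> space M | A. A \<in> sets borel} \<subseteq> \<A>"
    proof (rule \<A>.sigma_sets_subset, safe)
      fix A :: "real set"
      \<comment> \<open>A preimage under the indicator depends only on whether \<open>A\<close>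
        contains 1 and 0.\<close>
      have "indicat_real B -` A \<inter> space M =
          (if 1 \<in> A then B else {}) \<union> (if 0 \<in> A then space M - B else {})"
        using sets.sets_into_space[OF B_event] by (auto simp: indicator_def of_bool_def split: if_split_asm)
      moreover have "space M - B \<in> \<A>"
        using B by (rule \<A>.compl_sets)
      ultimately show "indicat_real B -` A \<inter> space M \<in> \<A>"
        using B \<A>.top by (simp add: \<A>.Un)
    qed
    have sub2: "sigma_sets (space M) {(\<lambda>\<omega>. g (X \<omega>)) -` A \<inter> space M | A. A \<in> sets borel} \<subseteq>
        sets (vimage_algebra (space M) X borel)"
    proof -
      have "(\<lambda>\<omega>. g (X \<omega>)) -` A \<inter> space M \<in> sets (vimage_algebra (space M) X borel)"
        if "A \<in> sets borel" for A
      proof -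
        have "g -` A \<in> sets borel"
          using measurable_sets[OF g that] by simp
        then have "X -` (g -` A) \<inter> space M \<in> sets (vimage_algebra (space M) X borel)"
          by (rule in_vimage_algebra)
        then show ?thesis
          by (simp only: vimage_def mem_Collect_eq)
      qed
      then have "{(\<lambda>\<omega>. g (X \<omega>)) -` A \<inter> space M | A. A \<in> sets borel} \<subseteq>
          sets (vimage_algebra (space M) X borel)"
        by blast
      from sets.sigma_sets_subset[OF this] show ?thesis
        by (simp only: space_vimage_algebra)
    qed
    show "indep_set
        (sigma_sets (space M) {indicat_real B -` A \<inter> space M | A. A \<in> sets borel})
        (sigma_sets (space M) {(\<lambda>\<omega>. g (X \<omega>)) -` A \<inter> space M | A. A \<in> sets borel})"
    proof (rule indep_setI)
      fix a b
      assume "a \<in> sigma_sets (space M) {indicat_real B -` A \<inter> space M | A. A \<in> sets borel}"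
        and "b \<in> sigma_sets (space M) {(\<lambda>\<omega>. g (X \<omega>)) -` A \<inter> space M | A. A \<in> sets borel}"
      then show "prob (a \<inter> b) = prob a * prob b"
        by (intro indep_setD[OF indep] subsetD[OF sub1] subsetD[OF sub2])
    qed (rule order_trans[OF sub1 indep_setD_ev1[OF indep]],
        rule order_trans[OF sub2 indep_setD_ev2[OF indep]])
  qed
  have int': "integrable M (indicat_real B)"
    using B_event by (intro integrable_real_indicator) (simp_all add: less_top[symmetric])
  show ?int
    by (rule indep_var_integrable[OF indep' int' int])
  have "expectation (indicat_real B) = prob B"
    using sets.sets_into_space[OF B_event] by (simp add: Int_absorb2)
  then show ?eq
    using indep_var_lebesgue_integral[OF indep' int' int] by (simp only:)
qed

text \<open>A prescribed history is an intersection of independent one-step events; selection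
  \<open>j\<close> sits at list position \<open>k - Suc j\<close>.\<close>

lemma (in prob_space) path_probability:
  fixes i :: "nat \<Rightarrow> 'a \<Rightarrow> 'm::finite"
  assumes indep: "indep_vars (\<lambda>_. count_space UNIV) i UNIV"
    and distr: "\<And>j r. prob {\<omega> \<in> space M. i j \<omega> = r} = p r"
    and len: "length rs = k"
  shows "prob {\<omega> \<in> space M. map (\<lambda>j. i j \<omega>) (rev [0..<k]) = rs} = prod_list (map p rs)"
\<comment> \<open>Length 0 is separate: an intersection over no indices would be \<open>UNIV\<close>
  rather than \<open>space M\<close>.\<close>
proof (cases "k = 0")
  case True
  then show ?thesis
    using len by (simp add: prob_space)
next
  case False
  have "{\<omega> \<in> space M. map (\<lambda>j. i j \<omega>) (rev [0..<k]) = rs} =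
      (\<Inter>j\<in>{..<k}. i j -` {rs ! (k - Suc j)} \<inter> space M)"
  proof -
    have "map (\<lambda>j. i j \<omega>) (rev [0..<k]) = rs \<longleftrightarrow> (\<forall>j<k. i j \<omega> = rs ! (k - Suc j))" for \<omega>
    proof -
      have "map (\<lambda>j. i j \<omega>) (rev [0..<k]) = rs \<longleftrightarrow> map (\<lambda>j. i j \<omega>) [0..<k] = rev rs"
        by (metis rev_map rev_rev_ident)
      then show ?thesis
        using len by (auto simp: list_eq_iff_nth_eq rev_nth)
    qed
    then show ?thesis
      using False by auto
  qed
  also have "prob \<dots> = (\<Prod>j<k. prob (i j -` {rs ! (k - Suc j)} \<inter> space M))"
    using indep False by (intro indep_varsD) auto
  also have "\<dots> = (\<Prod>j<k. p (rs ! (k - Suc j)))"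
    using distr by (intro prod.cong) (auto simp: vimage_def Int_def conj_commute)
  also have "\<dots> = (\<Prod>j<k. p (rs ! j))"
    by (rule prod.nat_diff_reindex)
  also have "\<dots> = prod_list (map p rs)"
    using len by (simp add: prod.list_conv_set_nth lessThan_atLeast0)
  finally show ?thesis .
qed

text \<open>The history takes finitely many values, and each of its events is independent of the
  noise. Splitting over these events replaces the random selections by \<open>path_avg\<close> at
  fixed noise.\<close>

lemma (in prob_space) expectation_path:
  fixes i :: "nat \<Rightarrow> 'a \<Rightarrow> 'm::finite" and g :: "'m list \<Rightarrow> 'b::topological_space \<Rightarrow> real"
    and k :: nat
  assumes indep: "indep_vars (\<lambda>_. count_space UNIV) i UNIV"
    and distr: "\<And>j r. prob {\<omega> \<in> space M. i j \<omega> = r} = p r"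
    and X: "random_variable borel X"
    and indep_X: "indep_set
         (sets (vimage_algebra (space M) (\<lambda>\<omega> j. i j \<omega>) (PiM UNIV (\<lambda>_. count_space UNIV))))
         (sets (vimage_algebra (space M) X borel))"
    and g: "\<And>rs. g rs \<in> borel_measurable borel" and int: "\<And>rs. integrable M (\<lambda>\<omega>. g rs (X \<omega>))"
  defines "hist \<equiv> \<lambda>\<omega>. map (\<lambda>j. i j \<omega>) (rev [0..<k])"
  shows "integrable M (\<lambda>\<omega>. g (hist \<omega>) (X \<omega>))" (is ?int)
    and "expectation (\<lambda>\<omega>. g (hist \<omega>) (X \<omega>)) = expectation (\<lambda>\<omega>. path_avg p k (\<lambda>rs. g rs (X \<omega>)))"
      (is ?eq)
proof -
  let ?N = "PiM (UNIV :: nat set) (\<lambda>_. count_space (UNIV :: 'm set))"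
  let ?V = "vimage_algebra (space M) (\<lambda>\<omega> j. i j \<omega>) ?N"
  let ?L = "{rs :: 'm list. length rs = k}"
  define B where "B rs = {\<omega> \<in> space M. hist \<omega> = rs}" for rs
  have path_set: "B rs \<in> sets ?V" for rs
  proof -
    \<comment> \<open>Only the first \<open>k\<close> coordinates matter, so the set is cut out by
      finitely many coordinate conditions.\<close>
    have "{s \<in> space ?N. map s (rev [0..<k]) = rs} =
        {s \<in> space ?N. length rs = k \<and> (\<forall>j\<in>{..<k}. s (rev [0..<k] ! j) = rs ! j)}"
      by (auto simp: list_eq_iff_nth_eq)
    also have "\<dots> \<in> sets ?N"
      by measurable
    finally have "(\<lambda>\<omega> j. i j \<omega>) -` {s \<in> space ?N. map s (rev [0..<k]) = rs} \<inter> space M \<in> sets ?V"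
      by (rule in_vimage_algebra)
    also have "(\<lambda>\<omega> j. i j \<omega>) -` {s \<in> space ?N. map s (rev [0..<k]) = rs} \<inter> space M = B rs"
      by (auto simp: B_def hist_def space_PiM)
    finally show ?thesis .
  qed
  have alg: "sigma_algebra (space M) (sets ?V)"
    using sets.sigma_algebra_axioms[of ?V] by simp
  note event = indep_set_expectation[OF indep_X X path_set alg g int]
  \<comment> \<open>At each point exactly one of the indicators equals 1.\<close>
  have split: "g (hist \<omega>) (X \<omega>) = (\<Sum>rs\<in>?L. indicat_real (B rs) \<omega> * g rs (X \<omega>))"
    if "\<omega> \<in> space M" for \<omega>
  proof -
    have "(\<Sum>rs\<in>?L. indicat_real (B rs) \<omega> * g rs (X \<omega>)) =
        (\<Sum>rs\<in>?L. if rs = hist \<omega> then g rs (X \<omega>) else 0)"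
      using that by (intro sum.cong) (auto simp: B_def)
    then show ?thesis
      by (simp add: hist_def)
  qed
  have "integrable M (\<lambda>\<omega>. \<Sum>rs\<in>?L. indicat_real (B rs) \<omega> * g rs (X \<omega>))"
    by (rule Bochner_Integration.integrable_sum) (rule event(1))
  then show ?int
    by (subst Bochner_Integration.integrable_cong[OF refl split])
  have "expectation (\<lambda>\<omega>. g (hist \<omega>) (X \<omega>)) =
      (\<Sum>rs\<in>?L. prob (B rs) * expectation (\<lambda>\<omega>. g rs (X \<omega>)))"
  proof -
    have "expectation (\<lambda>\<omega>. g (hist \<omega>) (X \<omega>)) =
        expectation (\<lambda>\<omega>. \<Sum>rs\<in>?L. indicat_real (B rs) \<omega> * g rs (X \<omega>))"
      by (rule Bochner_Integration.integral_cong[OF refl split])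
    also have "\<dots> = (\<Sum>rs\<in>?L. expectation (\<lambda>\<omega>. indicat_real (B rs) \<omega> * g rs (X \<omega>)))"
      by (rule Bochner_Integration.integral_sum) (rule event(1))
    finally show ?thesis
      by (simp only: event(2))
  qed
  also have "\<dots> = (\<Sum>rs\<in>?L. prod_list (map p rs) * expectation (\<lambda>\<omega>. g rs (X \<omega>)))"
    unfolding B_def hist_def by (intro sum.cong) (auto simp: path_probability[OF indep distr])
  finally show ?eq
    by (simp add: path_avg_def int)
qed

section \<open>Integrability of the noise terms\<close>

lemma linear_axis_expansion:
  fixes T :: "real^'m \<Rightarrow> 'v::real_vector"
  assumes "linear T"
  shows "T h = (\<Sum>r\<in>UNIV. h $ r *\<^sub>R T (axis r 1))"
proof -
  have "h = (\<Sum>r\<in>UNIV. h $ r *\<^sub>R axis r 1)"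
    using basis_expansion[of h] by (simp add: scalar_mult_eq_scaleR)
  then have "T h = T (\<Sum>r\<in>UNIV. h $ r *\<^sub>R axis r 1)"
    by simp
  then show ?thesis
    by (simp add: linear_sum[OF assms] linear_scale[OF assms])
qed

lemma integrable_linear:
  fixes X :: "'a \<Rightarrow> real^'m" and T :: "real^'m \<Rightarrow> 'v::{banach, second_countable_topology}"
  assumes "linear T" and "\<And>r. integrable M (\<lambda>\<omega>. X \<omega> $ r)"
  shows "integrable M (\<lambda>\<omega>. T (X \<omega>))"
  using assms(2) by (subst linear_axis_expansion[OF assms(1)]) auto

lemma integral_linear_eq_0:
  fixes X :: "'a \<Rightarrow> real^'m" and T :: "real^'m \<Rightarrow> 'v::{banach, second_countable_topology}"
  assumes "linear T" and "\<And>r. integrable M (\<lambda>\<omega>. X \<omega> $ r)" and "\<And>r. (\<integral>\<omega>. X \<omega> $ r \<partial>M) = 0"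
  shows "(\<integral>\<omega>. T (X \<omega>) \<partial>M) = 0"
  using assms(2,3) by (subst linear_axis_expansion[OF assms(1)]) simp

text \<open>Expanding both arguments in the standard basis leaves a finite combination of products
  of two components.\<close>

lemma integrable_bilinear:
  fixes X :: "'a \<Rightarrow> real^'m"
    and B :: "real^'m \<Rightarrow> real^'m \<Rightarrow> 'v::{banach, second_countable_topology}"
  assumes "bilinear B" and "\<And>r s. integrable M (\<lambda>\<omega>. X \<omega> $ r * X \<omega> $ s)"
  shows "integrable M (\<lambda>\<omega>. B (X \<omega>) (X \<omega>))"
proof -
  have lin: "linear (\<lambda>h. B h h')" "linear (B h)" for h h'
    using assms(1) by (auto simp: bilinear_def)
  have "B h h = (\<Sum>r\<in>UNIV. \<Sum>s\<in>UNIV. (h $ r * h $ s) *\<^sub>R B (axis r 1) (axis s 1))" for h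
    by (subst linear_axis_expansion[OF lin(1)], subst linear_axis_expansion[OF lin(2)])
      (simp add: scaleR_sum_right)
  then show ?thesis
    using assms(2) by simp
qed

lemma integrable_mult_of_squares:
  fixes u v :: "'a \<Rightarrow> real"
  assumes "integrable M (\<lambda>\<omega>. (u \<omega>)\<^sup>2)" and "integrable M (\<lambda>\<omega>. (v \<omega>)\<^sup>2)"
    and "u \<in> borel_measurable M" and "v \<in> borel_measurable M"
  shows "integrable M (\<lambda>\<omega>. u \<omega> * v \<omega>)"
proof (rule Bochner_Integration.integrable_bound)
  show "integrable M (\<lambda>\<omega>. (u \<omega>)\<^sup>2 + (v \<omega>)\<^sup>2)"
    using assms by simp
  have "\<bar>a * b\<bar> \<le> a\<^sup>2 + b\<^sup>2" for a b :: real
  proof -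
    have "2 * \<bar>a * b\<bar> \<le> a\<^sup>2 + b\<^sup>2"
      using sum_squares_bound[of "\<bar>a\<bar>" "\<bar>b\<bar>"] by (simp add: abs_mult mult.assoc)
    then show ?thesis
      using abs_ge_zero[of "a * b"] by linarith
  qed
  then show "AE \<omega> in M. norm (u \<omega> * v \<omega>) \<le> norm ((u \<omega>)\<^sup>2 + (v \<omega>)\<^sup>2)"
    by simp
qed (use assms in simp)

section \<open>Linear and continuous dependence on the noise\<close>

lemma linear_D_mat: "linear (D_mat A p)"
  by (rule linearI)
    (simp_all add: D_mat_def nnoise_def add_divide_distrib distrib_left scaleR_add_left sum.distrib
      scaleR_sum_right mult_ac)

lemma linear_f_vec: "linear (f_vec A p)"
  by (rule linearI)
    (simp_all add: f_vec_def nnoise_def add_divide_distrib distrib_left scaleR_add_left sum.distrib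
      scaleR_sum_right mult_ac)

lemma linear_v2_vec: "linear (v2_vec A p)"
  using linear_compose[OF linear_f_vec[of A p] matrix_vector_mul_linear[of "matrix_inv (mat 1 - P_mat A p)"]]
  by (simp add: v2_vec_def[abs_def] o_def)

lemma linear_mult_v2: "linear (\<lambda>h. B *v v2_vec A p h)"
  using linear_compose[OF linear_v2_vec matrix_vector_mul_linear] by (simp add: o_def)

lemma linear_D_mat_mult: "linear (\<lambda>h. D_mat A p h *v z)"
  using linear_D_mat[of A p]
  by (auto intro!: linearI simp: linear_add linear_scale matrix_vector_mult_add_rdistrib
      scaleR_matrix_vector_assoc)

text \<open>Linearity for a fixed vector \<open>z\<close> makes the term with the initial error
  vanish on average over centred noise.\<close>

lemma linear_fk_mat_D_mat: "linear (\<lambda>h. fk_mat A p k (D_mat A p h) *v z)"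
proof -
  have "linear (\<lambda>h. matpow (Q_mat A p) l *v (D_mat A p h *v v))" for l v
    using linear_compose[OF linear_D_mat_mult matrix_vector_mul_linear] by (simp add: o_def)
  then show ?thesis
    by (simp add: fk_mat_def matrix_vector_mult_sum_left linear_compose_sum
        flip: matrix_vector_mul_assoc)
qed

lemma continuous_path_error: "continuous_on UNIV (\<lambda>h. path_error A z0 h rs)"
  by (induction rs)
    (auto simp: nnoise_def divide_inverse
      intro!: continuous_intros bounded_linear.continuous_on[OF matrix_vector_mul_bounded_linear])

context
  fixes M :: "'a measure" and X :: "'a \<Rightarrow> real^'m"
  assumes prob: "prob_space M"
    and X: "X \<in> borel_measurable M"
    and square: "\<And>r. integrable M (\<lambda>\<omega>. (X \<omega> $ r)\<^sup>2)"
begin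

interpretation prob_space M
  by (rule prob)

lemma measurable_component: "(\<lambda>\<omega>. X \<omega> $ r) \<in> borel_measurable M"
  using X by (rule measurable_compose) (intro borel_measurable_continuous_onI continuous_intros)

lemma integrable_component: "integrable M (\<lambda>\<omega>. X \<omega> $ r)"
  using measurable_component square by (rule square_integrable_imp_integrable)

lemma integrable_component_mult: "integrable M (\<lambda>\<omega>. X \<omega> $ r * X \<omega> $ s)"
  by (intro integrable_mult_of_squares square measurable_component)

text \<open>The expression is quadratic in the noise, one factor entering through
  \<open>D_mat\<close> and the other through \<open>v2_vec\<close>.\<close>

lemma integrable_fk_mat_v2: "integrable M (\<lambda>\<omega>. fk_mat A p k (D_mat A p (X \<omega>)) *v v2_vec A p (X \<omega>))"
proof (rule integrable_bilinear[where B = "\<lambda>h h'. fk_mat A p k (D_mat A p h) *v v2_vec A p h'"])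
  show "bilinear (\<lambda>h h'. fk_mat A p k (D_mat A p h) *v v2_vec A p h')"
    by (simp add: bilinear_def linear_mult_v2 linear_fk_mat_D_mat)
qed (rule integrable_component_mult)

lemma integrable_v1: "integrable M (\<lambda>\<omega>. v1_vec A p (X \<omega>))"
proof -
  have "integrable M (\<lambda>\<omega>. D_mat A p (X \<omega>) *v v2_vec A p (X \<omega>))"
  proof (rule integrable_bilinear[where B = "\<lambda>h h'. D_mat A p h *v v2_vec A p h'"])
    show "bilinear (\<lambda>h h'. D_mat A p h *v v2_vec A p h')"
      by (simp add: bilinear_def linear_mult_v2 linear_D_mat_mult)
  qed (rule integrable_component_mult)
  moreover have "integrable M (\<lambda>\<omega>. e_vec A p (X \<omega>))"
    using square by (simp add: e_vec_def nnoise_def power_divide)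
  ultimately show ?thesis
    unfolding v1_vec_def
    by (intro integrable_bounded_linear[OF matrix_vector_mul_bounded_linear] Bochner_Integration.integrable_add)
qed

text \<open>Along a history each step applies a bounded linear map and adds a multiple of one noise
  entry. The bound \<open>(a + b)^2 <= 2 * (a^2 + b^2)\<close> carries square integrability from
  step to step.\<close>

lemma integrable_norm_path_error: "integrable M (\<lambda>\<omega>. (norm (path_error A z0 (X \<omega>) rs))\<^sup>2)"
proof (induction rs)
  case (Cons r rs)
  let ?c = "(onorm ((*v) (proj_perp A r)))\<^sup>2"
  let ?Z = "\<lambda>\<omega>. path_error A z0 (X \<omega>)"
  show ?case
  proof (rule Bochner_Integration.integrable_bound)
    show "integrable M (\<lambda>\<omega>. 2 * (?c * (norm (?Z \<omega> rs))\<^sup>2 + (norm (nrow A r) / norm (row r A))\<^sup>2 * (X \<omega> $ r)\<^sup>2))"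
      using Cons.IH square by simp
    have meas: "(\<lambda>\<omega>. ?Z \<omega> (r # rs)) \<in> borel_measurable M"
      using measurable_compose[OF X borel_measurable_continuous_onI[OF continuous_path_error]] .
    show "(\<lambda>\<omega>. (norm (?Z \<omega> (r # rs)))\<^sup>2) \<in> borel_measurable M"
      using meas by measurable
    have "(norm (?Z \<omega> (r # rs)))\<^sup>2 \<le>
        2 * (?c * (norm (?Z \<omega> rs))\<^sup>2 + (norm (nrow A r) / norm (row r A))\<^sup>2 * (X \<omega> $ r)\<^sup>2)" for \<omega>
    proof -
      let ?a = "norm (proj_perp A r *v ?Z \<omega> rs)" and ?b = "norm (nnoise A (X \<omega>) r *\<^sub>R nrow A r)"
      have "(norm (?Z \<omega> (r # rs)))\<^sup>2 \<le> (?a + ?b)\<^sup>2"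
        by (simp add: norm_triangle_ineq power_mono del: norm_scaleR)
      also have "\<dots> \<le> 2 * (?a\<^sup>2 + ?b\<^sup>2)"
        using sum_squares_bound[of ?a ?b] by (simp add: power2_sum del: norm_scaleR)
      also have "?a\<^sup>2 \<le> ?c * (norm (?Z \<omega> rs))\<^sup>2"
        using power_mono[OF onorm[OF matrix_vector_mul_bounded_linear, of "proj_perp A r" "?Z \<omega> rs"], of 2]
        by (simp add: power_mult_distrib)
      also have "?b\<^sup>2 = (norm (nrow A r) / norm (row r A))\<^sup>2 * (X \<omega> $ r)\<^sup>2"
        by (simp add: nnoise_def power_mult_distrib power_divide)
      finally show ?thesis
        by simp
    qed
    then show "AE \<omega> in M. norm ((norm (?Z \<omega> (r # rs)))\<^sup>2) \<le>
        norm (2 * (?c * (norm (?Z \<omega> rs))\<^sup>2 + (norm (nrow A r) / norm (row r A))\<^sup>2 * (X \<omega> $ r)\<^sup>2))"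
      by (intro AE_I2) (simp only: real_norm_def abs_power2 order_trans[OF _ abs_ge_self])
  qed
qed simp

end

section \<open>Averaging over selections and noise together\<close>

theorem proposition3:
  fixes A :: "real^'n^'m"
    and p :: "'m \<Rightarrow> real"
    and x x0 :: "real^'n"
    and \<sigma> :: real
    and M :: "'a measure"
    and \<eta> :: "'a \<Rightarrow> real^'m"
    and i :: "nat \<Rightarrow> 'a \<Rightarrow> 'm"
    and k :: nat
  assumes dims: "CARD('n) \<le> CARD('m)"
    and full_rank: "rank A = min CARD('m) CARD('n)"
    and nonzero_rows: "\<And>r. row r A \<noteq> 0"
    and p_pos: "\<And>r. p r > 0"
    and p_sum: "(\<Sum>r\<in>UNIV. p r) = 1"
    and prob: "prob_space M"
    and noise_indep: "prob_space.indep_vars M (\<lambda>_. borel) (\<lambda>r \<omega>. \<eta> \<omega> $ r) UNIV"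
    and noise_ident: "\<And>r s. distr M borel (\<lambda>\<omega>. \<eta> \<omega> $ r) = distr M borel (\<lambda>\<omega>. \<eta> \<omega> $ s)"
    and noise_square_integrable: "\<And>r. integrable M (\<lambda>\<omega>. (\<eta> \<omega> $ r)\<^sup>2)"
    and noise_mean: "\<And>r. prob_space.expectation M (\<lambda>\<omega>. \<eta> \<omega> $ r) = 0"
    and noise_variance: "\<And>r. prob_space.variance M (\<lambda>\<omega>. \<eta> \<omega> $ r) = \<sigma>\<^sup>2"
    and rows_indep: "prob_space.indep_vars M (\<lambda>_. count_space UNIV) i UNIV"
    and rows_distr: "\<And>j r. prob_space.prob M {\<omega> \<in> space M. i j \<omega> = r} = p r"
    and rows_noise_indep:
      "prob_space.indep_set M
         (sets (vimage_algebra (space M) (\<lambda>\<omega> j. i j \<omega>) (PiM UNIV (\<lambda>_. count_space UNIV))))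
         (sets (vimage_algebra (space M) \<eta> borel))"
  shows
    "prob_space.expectation M
       (cond_exp_given M \<eta>
         (\<lambda>\<omega>. (norm (kaczmarz A (A *v x + \<eta> \<omega>) x0 (\<lambda>j. i j \<omega>) k - x))\<^sup>2)) =
       vec_of_mat (mat 1 :: real^'n^'n) \<bullet>
         (matpow (Q_mat A p) k *v
            (kron_vec (x0 - x) (x0 - x) -
             prob_space.expectation M (\<lambda>\<omega>. v1_vec A p (\<eta> \<omega>))) -
          prob_space.expectation M
            (\<lambda>\<omega>. fk_mat A p k (D_mat A p (\<eta> \<omega>)) *v v2_vec A p (\<eta> \<omega>)))
       + trace (mat_of_vec (prob_space.expectation M (\<lambda>\<omega>. v1_vec A p (\<eta> \<omega>))))"
proof -
  interpret prob_space M
    by (rule prob)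
  \<comment> \<open>As there are at least as many rows as columns, full rank means full column rank,
    hence injectivity.\<close>
  have inj: "inj ((*v) A)"
    using full_rank dims by (simp add: full_rank_injective[symmetric] min_def)
  have component: "random_variable borel (\<lambda>\<omega>. \<eta> \<omega> $ r)" for r
    using noise_indep by (simp add: indep_vars_def2)
  then have X: "random_variable borel \<eta>"
    by (rule measurable_vec_lambda)
  note noise = prob X noise_square_integrable
  define z0 where "z0 = x0 - x"
  let ?V = "vec_of_mat (mat 1 :: real^'n^'n)" and ?Q = "matpow (Q_mat A p) k"
  let ?F = "\<lambda>h z. fk_mat A p k (D_mat A p h) *v z"
  let ?Z = "\<lambda>\<omega>. path_error A z0 (\<eta> \<omega>)"
  let ?E = "\<lambda>\<omega>. (norm (kaczmarz A (A *v x + \<eta> \<omega>) x0 (\<lambda>j. i j \<omega>) k - x))\<^sup>2"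
  note path = expectation_path[OF rows_indep rows_distr X rows_noise_indep,
      where g = "\<lambda>rs h. (norm (path_error A z0 h rs))\<^sup>2" and k = k]
  have E_eq: "?E = (\<lambda>\<omega>. (norm (?Z \<omega> (map (\<lambda>j. i j \<omega>) (rev [0..<k]))))\<^sup>2)"
    by (simp add: kaczmarz_eq_path_error[OF nonzero_rows] z0_def)
  have meas: "(\<lambda>h. (norm (path_error A z0 h rs))\<^sup>2) \<in> borel_measurable borel" for rs
    by (intro borel_measurable_continuous_onI continuous_intros continuous_path_error)
  have E_int: "integrable M ?E"
    unfolding E_eq by (rule path(1)[OF meas integrable_norm_path_error[OF noise]])

  \<comment> \<open>The noise generates a subalgebra of \<open>M\<close>, so the conditional
    expectation integrates to the plain expectation.\<close>
  interpret finite_measure_subalgebra M "vimage_algebra (space M) \<eta> borel"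
    using sets_image_in_sets[OF refl X] by unfold_locales (simp add: subalgebra_def)
  have "expectation (cond_exp_given M \<eta> ?E) = expectation ?E"
    unfolding cond_exp_given_def by (rule real_cond_exp_int(2)[OF E_int])
  also have "\<dots> = expectation (\<lambda>\<omega>. path_avg p k (\<lambda>rs. (norm (?Z \<omega> rs))\<^sup>2))"
    unfolding E_eq by (rule path(2)[OF meas integrable_norm_path_error[OF noise]])
  also have "\<dots> = expectation (\<lambda>\<omega>. ?V \<bullet> (?Q *v (kron_vec z0 z0 - v1_vec A p (\<eta> \<omega>)) +
      v1_vec A p (\<eta> \<omega>) + ?F (\<eta> \<omega>) (z0 - v2_vec A p (\<eta> \<omega>))))"
    by (simp only: path_avg_norm_error path_avg_kron_error[OF inj nonzero_rows p_pos p_sum])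
  also have "\<dots> = ?V \<bullet> (?Q *v (kron_vec z0 z0 - expectation (\<lambda>\<omega>. v1_vec A p (\<eta> \<omega>))) +
      expectation (\<lambda>\<omega>. v1_vec A p (\<eta> \<omega>)) -
      expectation (\<lambda>\<omega>. ?F (\<eta> \<omega>) (v2_vec A p (\<eta> \<omega>))))"
  proof -
    have lin: "linear (\<lambda>h. ?F h z0)"
      by (rule linear_fk_mat_D_mat)
    note v1 = integrable_v1[OF noise, of A p]
    note Fv2 = integrable_fk_mat_v2[OF noise, of A p k]
    note Fz0 = integrable_linear[OF lin integrable_component[OF noise]]
    note mult = matrix_vector_mul_bounded_linear[of ?Q]
    have v1': "integrable M (\<lambda>\<omega>. kron_vec z0 z0 - v1_vec A p (\<eta> \<omega>))"
      using v1 by simp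
    have Qv1: "integrable M (\<lambda>\<omega>. ?Q *v (kron_vec z0 z0 - v1_vec A p (\<eta> \<omega>)))"
      by (rule integrable_bounded_linear[OF mult v1'])
    \<comment> \<open>The initial error \<open>z0\<close> is deterministic, so this term is linear
      in the centred noise; only the \<open>v2_vec\<close> part of the transient survives.\<close>
    have "expectation (\<lambda>\<omega>. ?F (\<eta> \<omega>) z0) = 0"
      by (rule integral_linear_eq_0[OF lin integrable_component[OF noise] noise_mean])
    moreover have "expectation (\<lambda>\<omega>. ?Q *v (kron_vec z0 z0 - v1_vec A p (\<eta> \<omega>))) =
        ?Q *v (kron_vec z0 z0 - expectation (\<lambda>\<omega>. v1_vec A p (\<eta> \<omega>)))"
      using v1 by (simp add: integral_bounded_linear[OF mult v1'] prob_space)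
    ultimately show ?thesis
      using v1 Fv2 Fz0 Qv1
      by (simp add: matrix_vector_mult_diff_distrib[of "fk_mat A p k _"])
  qed
  finally show ?thesis
    by (simp add: z0_def inner_add_right inner_diff_right vec_mat_1_inner)
qed

end
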